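(* Let $\boldsymbol{X}=(X_1,\dots,X_d)=(Y_1,\dots,Y_d)+(Z_1,\dots,Z_d)$ follow the multivariate comonotonic shock Poisson distribution with parameters $(\lambda_1,\dots,\lambda_d)\in(0,\infty)^d$ and $\theta\in[0,1]$, and let $i\in\{1,\dots,d\}$. Then for every $x\in\mathbb N=\{0,1,2,\dots\}$, as $\lambda_i\to\infty$ with all other parameters fixed, $$F_{M^{\boldsymbol X}}(x)\sim F_{X_i}(x)\,F_{M_{-i}^{\boldsymbol Y}}(x),\qquad F_{m^{\boldsymbol X}}(x)\sim F_{m_{-i}^{\boldsymbol X}}(x).$$
   Context: $\mathcal P(\lambda)$ denotes the Poisson distribution with rate $\lambda\ge0$ ($\mathcal P(0)$ is the point mass at $0$) and $G_\lambda$ its cumulative distribution function. A random vector $(X_1,\dots,X_d)$ follows the multivariate comonotonic shock Poisson distribution with parameters $(\lambda_1,\dots,\lambda_d)\in(0,\infty)^d$ and $\theta\in[0,1]$ if $(X_1,\dots,X_d)=(Y_1,\dots,Y_d)+(Z_1,\dots,Z_d)$, where the vectors $\boldsymbol Y=(Y_1,\dots,Y_d)$ and $\boldsymbol Z=(Z_1,\dots,Z_d)$ are independent of each other and: (i) $Y_1,\dots,Y_d$ are mutually independent with $Y_j\sim\mathcal P((1-\theta)\lambda_j)$; (ii) $Z_1,\dots,Z_d$ are comonotonic with $Z_j\sim\mathcal P(\theta\lambda_j)$, i.e. $(Z_1,\dots,Z_d)=(G_{\theta\lambda_1}^{-1}(U),\dots,G_{\theta\lambda_d}^{-1}(U))$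 for one random variable $U$ uniform on $(0,1)$, where $F^{-1}(u)=\inf\{t\in\mathbb R:F(t)\ge u\}$. For a random vector $\boldsymbol\xi=(\xi_1,\dots,\xi_d)$: $M^{\boldsymbol\xi}=\max(\xi_1,\dots,\xi_d)$, $m^{\boldsymbol\xi}=\min(\xi_1,\dots,\xi_d)$, and $M_{-i}^{\boldsymbol\xi}$, $m_{-i}^{\boldsymbol\xi}$ are the maximum and minimum of the components $\xi_j$ with $j\ne i$. $F_W$ denotes the cumulative distribution function of a random variable $W$. The notation $f(x;\kappa)\sim g(x;\kappa)$ as $\kappa\to\kappa_0$ means $\lim_{\kappa\to\kappa_0}f(x;\kappa)/g(x;\kappa)=1$. *)

theory Defs
  imports "HOL-Probability.Probability"
begin

text \<open>
  The library's \<open>poisson_pmf\<close> is specified only for a strictly positive rate, so the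
  degenerate case of rate 0 (point mass at 0) is added by hand. The law is transported to the
  reals so that distribution functions and quantile functions live on \<open>real\<close>.
\<close>

definition poisson_law :: "real \<Rightarrow> real measure" where
  "poisson_law r =
     distr (measure_pmf (if r = 0 then return_pmf 0 else poisson_pmf r)) borel real"

definition quantile :: "(real \<Rightarrow> real) \<Rightarrow> real \<Rightarrow> real" where
  "quantile F u = Inf {t. u \<le> F t}"

definition cdf_of :: "'a measure \<Rightarrow> ('a \<Rightarrow> real) \<Rightarrow> real \<Rightarrow> real" where
  "cdf_of M W = cdf (distr M borel W)"

text \<open>
  Random vectors are families indexed by natural numbers; only the indices in \<open>{1..d}\<close>
  matter. \<open>Max\<close> and \<open>Min\<close> are meaningful for finite nonempty index sets only.
\<close>

definition vmax :: "nat set \<Rightarrow> (nat \<Rightarrow> 'a \<Rightarrow> real) \<Rightarrow> 'a \<Rightarrow> real" where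
  "vmax I \<xi> \<omega> = Max ((\<lambda>j. \<xi> j \<omega>) ` I)"

definition vmin :: "nat set \<Rightarrow> (nat \<Rightarrow> 'a \<Rightarrow> real) \<Rightarrow> 'a \<Rightarrow> real" where
  "vmin I \<xi> \<omega> = Min ((\<lambda>j. \<xi> j \<omega>) ` I)"

locale comonotonic_shock_poisson = prob_space M
  for M :: "'a measure" +
  fixes d :: nat and lam :: "nat \<Rightarrow> real" and \<theta> :: real
    and X Y Z :: "nat \<Rightarrow> 'a \<Rightarrow> real"
  assumes lam_pos: "\<And>j. j \<in> {1..d} \<Longrightarrow> 0 < lam j"
    and theta_range: "0 \<le> \<theta>" "\<theta> \<le> 1"
    and X_eq: "\<And>j \<omega>. j \<in> {1..d} \<Longrightarrow> \<omega> \<in> space M \<Longrightarrow> X j \<omega> = Y j \<omega> + Z j \<omega>"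
    and Y_rv: "\<And>j. j \<in> {1..d} \<Longrightarrow> random_variable borel (Y j)"
    and Z_rv: "\<And>j. j \<in> {1..d} \<Longrightarrow> random_variable borel (Z j)"
    and YZ_indep: "indep_var
          (PiM {1..d} (\<lambda>_. borel)) (\<lambda>\<omega>. \<lambda>j\<in>{1..d}. Y j \<omega>)
          (PiM {1..d} (\<lambda>_. borel)) (\<lambda>\<omega>. \<lambda>j\<in>{1..d}. Z j \<omega>)"
    and Y_indep: "indep_vars (\<lambda>_. borel) Y {1..d}"
    and Y_law: "\<And>j. j \<in> {1..d} \<Longrightarrow> distr M borel (Y j) = poisson_law ((1 - \<theta>) * lam j)"
    and Z_law: "\<And>j. j \<in> {1..d} \<Longrightarrow> distr M borel (Z j) = poisson_law (\<theta> * lam j)"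
    and Z_comonotonic: "\<exists>U. random_variable borel U
          \<and> distr M borel U = uniform_measure lborel {0<..<1}
          \<and> (AE \<omega> in M. \<forall>j\<in>{1..d}. Z j \<omega> = quantile (cdf (poisson_law (\<theta> * lam j))) (U \<omega>))"

end

theory Submission
  imports Defs
begin

text \<open>
  If \<open>\<theta> > 0\<close> and \<open>\<lambda>\<^sub>i\<close> is large, the event \<open>Z\<^sub>i \<le> x\<close> confines the common uniform variable to so
  small an interval that every other shock \<open>Z\<^sub>j\<close> vanishes there; if \<open>\<theta> = 0\<close> all shocks vanish anyway.
  Hence \<open>{M\<^sup>X \<le> x}\<close> agrees almost surely with the event that \<open>X\<^sub>i \<le> x\<close> and \<open>Y\<^sub>j \<le> x\<close> for \<open>j \<noteq> i\<close>,
  and by independence the first ratio is eventually equal to 1. For the minimum, the two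
  distribution functions differ by at most \<open>P(X\<^sub>i \<le> x)\<close>, which tends to 0, while the denominator is
  at least the constant \<open>P(X\<^sub>j = 0) = exp (- \<lambda>\<^sub>j)\<close> for any \<open>j \<noteq> i\<close>.
\<close>

section \<open>Poisson distribution functions: values, lower bound and decay\<close>

lemma real_distribution_poisson_law: "real_distribution (poisson_law r)"
  unfolding poisson_law_def
  by (intro prob_space.real_distribution_distr measure_pmf.prob_space_axioms) auto

lemma cdf_poisson_law_eq_0: "x < 0 \<Longrightarrow> cdf (poisson_law r) x = 0"
  unfolding cdf_def poisson_law_def
  by (subst measure_distr) (auto simp: vimage_def not_le)

lemma cdf_poisson_law_nat:
  assumes "0 < r"
  shows "cdf (poisson_law r) (real n) = (\<Sum>k\<le>n. r ^ k / fact k * exp (- r))"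
proof -
  have "cdf (poisson_law r) (real n) = measure (measure_pmf (poisson_pmf r)) {..n}"
    using assms unfolding cdf_def poisson_law_def
    by (subst measure_distr) (auto simp: vimage_def atMost_def)
  also have "\<dots> = (\<Sum>k\<le>n. pmf (poisson_pmf r) k)"
    by (rule measure_measure_pmf_finite) auto
  finally show ?thesis
    using assms by simp
qed

lemma cdf_poisson_law_0:
  assumes "0 \<le> r"
  shows "cdf (poisson_law r) 0 = exp (- r)"
proof (cases "r = 0")
  case True
  then show ?thesis
    unfolding cdf_def poisson_law_def
    by (subst measure_distr) (auto simp: vimage_def indicator_def)
next
  case False
  then show ?thesis
    using cdf_poisson_law_nat[of r 0] assms by simp
qed

text \<open>The atom at 0 alone has mass exp (- r). This keeps the distribution functions of the
  \<open>Y j\<close> positive at every nonnegative point.\<close>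

lemma cdf_poisson_law_ge:
  assumes "0 \<le> r" "0 \<le> x"
  shows "exp (- r) \<le> cdf (poisson_law r) x"
proof -
  interpret real_distribution "poisson_law r"
    by (rule real_distribution_poisson_law)
  show ?thesis
    using cdf_nondecreasing[OF assms(2)] cdf_poisson_law_0[OF assms(1)] by simp
qed

text \<open>The number of summands stays fixed while the rate grows, and in each of them the
  exponential beats the power.\<close>

lemma cdf_poisson_law_tendsto_0: "((\<lambda>r. cdf (poisson_law r) (real n)) \<longlongrightarrow> 0) at_top"
proof -
  have "((\<lambda>r::real. \<Sum>k\<le>n. r ^ k / fact k * exp (- r)) \<longlongrightarrow> (\<Sum>k\<le>n. 0)) at_top"
  proof (intro tendsto_sum)
    fix k
    have "((\<lambda>r::real. (r ^ k / exp r) / fact k) \<longlongrightarrow> 0 / fact k) at_top"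
      by (intro tendsto_divide tendsto_power_div_exp_0 tendsto_const) auto
    then show "((\<lambda>r::real. r ^ k / fact k * exp (- r)) \<longlongrightarrow> 0) at_top"
      by (simp add: exp_minus field_simps)
  qed
  \<comment> \<open>The explicit sum is available for positive rates, hence eventually.\<close>
  moreover have "\<forall>\<^sub>F r in at_top. (\<Sum>k\<le>n. r ^ k / fact k * exp (- r)) = cdf (poisson_law r) (real n)"
    using eventually_gt_at_top[of 0] by eventually_elim (simp add: cdf_poisson_law_nat)
  ultimately show ?thesis
    by (simp add: tendsto_cong)
qed

lemma cdf_poisson_law_scaled_tendsto_0:
  assumes "0 < c"
  shows "((\<lambda>t. cdf (poisson_law (c * t)) (real n)) \<longlongrightarrow> 0) at_top"
  using assms
  by (intro filterlim_compose[OF cdf_poisson_law_tendsto_0]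
      filterlim_tendsto_pos_mult_at_top[OF tendsto_const] filterlim_ident)

section \<open>Independence of joined blocks, and distribution functions as probabilities\<close>

lemma (in prob_space) indep_vars_insert:
  assumes W: "indep_vars N W I" and "finite I" "k \<notin> I"
    and Wk: "indep_var (PiM I N) (\<lambda>\<omega>. \<lambda>j\<in>I. W j \<omega>) (PiM {k} N) (\<lambda>\<omega>. \<lambda>j\<in>{k}. W j \<omega>)"
  shows "indep_vars N W (insert k I)"
proof -
  let ?F = "\<lambda>j. {W j -` A \<inter> space M | A. A \<in> sets (N j)}"
  have "random_variable (PiM {k} N) (\<lambda>\<omega>. \<lambda>j\<in>{k}. W j \<omega>)"
    using Wk by (simp add: indep_var_eq)
  from measurable_compose[OF this measurable_component_singleton[of k]]
  have rv: "random_variable (N j) (W j)" if "j \<in> insert k I" for j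
    using that W by (auto simp: indep_vars_def)
  \<comment> \<open>Each family of preimages contains \<open>space M\<close>, so
    \<open>indep_sets_finite\<close> asks for the product rule on the full index set only; smaller
    subsets follow by choosing \<open>space M\<close> at the remaining indices.\<close>
  have "indep_sets ?F (insert k I)"
  proof (subst indep_sets_finite)
    show "insert k I \<noteq> {}" "finite (insert k I)"
      using \<open>finite I\<close> by auto
    show "?F j \<subseteq> events" if "j \<in> insert k I" for j
      using measurable_sets[OF rv[OF that]] by blast
    show "space M \<in> ?F j" if "j \<in> insert k I" for j
      using measurable_space[OF rv[OF that]] by (intro CollectI exI[of _ "space (N j)"]) auto
    show "\<forall>A\<in>Pi (insert k I) ?F. prob (\<Inter>j\<in>insert k I. A j) = (\<Prod>j\<in>insert k I. prob (A j))"
    proof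
      fix A assume "A \<in> Pi (insert k I) ?F"
      then have "\<forall>j\<in>insert k I. \<exists>B. A j = W j -` B \<inter> space M \<and> B \<in> sets (N j)"
        by (auto simp: Pi_iff)
      then obtain B where B: "\<And>j. j \<in> insert k I \<Longrightarrow> A j = W j -` B j \<inter> space M"
          "\<And>j. j \<in> insert k I \<Longrightarrow> B j \<in> sets (N j)"
        by metis
      \<comment> \<open>The intersection is the preimage of a rectangle under the pair of blocks.
        Independence of the blocks splits off \<open>A k\<close>, and independence within
        \<open>I\<close> splits the rest.\<close>
      have "prob (\<Inter>j\<in>insert k I. A j) =
        prob ((\<lambda>\<omega>. (\<lambda>j\<in>I. W j \<omega>, \<lambda>j\<in>{k}. W j \<omega>)) -` (Pi\<^sub>E I B \<times> Pi\<^sub>E {k} B) \<inter> space M)"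
        using B by (intro arg_cong[where f = prob]) (auto simp: PiE_iff fun_eq_iff)
      also have "\<dots> = prob ((\<lambda>\<omega>. \<lambda>j\<in>I. W j \<omega>) -` Pi\<^sub>E I B \<inter> space M) *
          prob ((\<lambda>\<omega>. \<lambda>j\<in>{k}. W j \<omega>) -` Pi\<^sub>E {k} B \<inter> space M)"
        using \<open>finite I\<close> B by (intro indep_varD[OF Wk] sets_PiM_I_finite) auto
      also have "(\<lambda>\<omega>. \<lambda>j\<in>{k}. W j \<omega>) -` Pi\<^sub>E {k} B \<inter> space M = A k"
        using B(1)[of k] by (auto simp: PiE_iff)
      \<comment> \<open>The empty index set is treated apart because \<open>indep_varsD\<close>
        requires a nonempty one.\<close>
      also have "prob ((\<lambda>\<omega>. \<lambda>j\<in>I. W j \<omega>) -` Pi\<^sub>E I B \<inter> space M) = (\<Prod>j\<in>I. prob (A j))"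
      proof (cases "I = {}")
        case True
        then have "(\<lambda>\<omega>. \<lambda>j\<in>I. W j \<omega>) -` Pi\<^sub>E I B \<inter> space M = space M"
          by (auto simp: fun_eq_iff)
        with True show ?thesis
          by (simp add: prob_space)
      next
        case False
        then have "(\<lambda>\<omega>. \<lambda>j\<in>I. W j \<omega>) -` Pi\<^sub>E I B \<inter> space M = (\<Inter>j\<in>I. W j -` B j \<inter> space M)"
          by (auto simp: PiE_iff)
        then show ?thesis
          using indep_varsD[OF W False \<open>finite I\<close> subset_refl, of B] B by simp
      qed
      finally show "prob (\<Inter>j\<in>insert k I. A j) = (\<Prod>j\<in>insert k I. prob (A j))"
        using \<open>finite I\<close> \<open>k \<notin> I\<close> by (simp add: mult.commute)
    qed
  qed
  then show ?thesis
    unfolding indep_vars_def2 using rv by blast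
qed

lemma (in prob_space) prob_le_eq_cdf:
  assumes "random_variable borel W" "distr M borel W = L"
  shows "prob {\<omega> \<in> space M. W \<omega> \<le> x} = cdf L x"
proof -
  have "W -` {..x} \<inter> space M = {\<omega> \<in> space M. W \<omega> \<le> x}"
    by auto
  then show ?thesis
    using assms by (auto simp: cdf_def measure_distr)
qed

lemma (in prob_space) cdf_of_eq_prob:
  assumes "random_variable borel W"
  shows "cdf_of M W x = prob {\<omega> \<in> space M. W \<omega> \<le> x}"
  using prob_le_eq_cdf[OF assms refl] by (simp add: cdf_of_def)

lemma (in prob_space) AE_nonneg_if_poisson_law:
  assumes W[measurable]: "random_variable borel W" and L: "distr M borel W = poisson_law r"
  shows "AE \<omega> in M. 0 \<le> W \<omega>"
proof -
  have "AE w in poisson_law r. 0 \<le> w"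
    unfolding poisson_law_def by (subst AE_distr_iff) auto
  then show ?thesis
    unfolding L[symmetric] by (subst (asm) AE_distr_iff) auto
qed

text \<open>Both strict bounds serve the quantile: \<open>U \<omega> < 1\<close> makes the set under
  the infimum nonempty, and \<open>0 < U \<omega>\<close> keeps negative points out of it when the
  law is Poisson.\<close>

lemma (in prob_space) AE_uniform:
  assumes "random_variable borel U" "distr M borel U = uniform_measure lborel {0<..<1::real}"
  shows "AE \<omega> in M. 0 < U \<omega> \<and> U \<omega> < 1"
proof -
  have "AE u in uniform_measure lborel {0<..<1::real}. 0 < u \<and> u < 1"
    by (intro AE_uniform_measureI) auto
  then show ?thesis
    unfolding assms(2)[symmetric] using assms(1) by (subst (asm) AE_distr_iff) auto
qed

lemma (in prob_space) cdf_of_vmax: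
  assumes "finite I" "I \<noteq> {}" "\<And>j. j \<in> I \<Longrightarrow> random_variable borel (\<xi> j)"
  shows "cdf_of M (vmax I \<xi>) x = prob {\<omega> \<in> space M. \<forall>j\<in>I. \<xi> j \<omega> \<le> x}"
proof -
  have "random_variable borel (vmax I \<xi>)"
    unfolding vmax_def using assms by (intro borel_measurable_Max)
  then show ?thesis
    using assms by (simp add: cdf_of_eq_prob vmax_def)
qed

lemma (in prob_space) cdf_of_vmin:
  assumes "finite I" "I \<noteq> {}" "\<And>j. j \<in> I \<Longrightarrow> random_variable borel (\<xi> j)"
  shows "cdf_of M (vmin I \<xi>) x = prob {\<omega> \<in> space M. \<exists>j\<in>I. \<xi> j \<omega> \<le> x}"
proof -
  have "random_variable borel (vmin I \<xi>)"
    unfolding vmin_def using assms by (intro borel_measurable_Min)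
  then show ?thesis
    using assms by (simp add: cdf_of_eq_prob vmin_def Min_le_iff)
qed

section \<open>The shock vector at fixed parameters\<close>

context comonotonic_shock_poisson
begin

lemma X_rv: "j \<in> {1..d} \<Longrightarrow> random_variable borel (X j)"
  using measurable_cong[of M "X j" "\<lambda>\<omega>. Y j \<omega> + Z j \<omega>" borel] X_eq[of j] Y_rv[of j] Z_rv[of j]
  by simp

lemma AE_nonneg: "AE \<omega> in M. \<forall>j\<in>{1..d}. 0 \<le> Y j \<omega> \<and> 0 \<le> Z j \<omega>"
  using AE_nonneg_if_poisson_law[OF Y_rv Y_law] AE_nonneg_if_poisson_law[OF Z_rv Z_law]
  by (intro AE_finite_allI AE_conjI) auto

lemma rate_nonneg:
  assumes "j \<in> {1..d}"
  shows "0 \<le> (1 - \<theta>) * lam j" "0 \<le> \<theta> * lam j"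
  using lam_pos[OF assms] theta_range by auto

text \<open>
  Evaluating the distribution function at \<open>x + 1\<close> instead of \<open>x\<close> avoids having to show that the
  infimum in the quantile is attained.
\<close>

lemma AE_shock_eq_0:
  assumes "i \<in> {1..d}"
    and small: "\<And>j. j \<in> J \<Longrightarrow> \<theta> = 0 \<or> cdf (poisson_law (\<theta> * lam i)) (x + 1) \<le> exp (- (\<theta> * lam j))"
    and "J \<subseteq> {1..d}"
  shows "AE \<omega> in M. Z i \<omega> \<le> x \<longrightarrow> (\<forall>j\<in>J. Z j \<omega> = 0)"
proof -
  let ?G = "\<lambda>j. cdf (poisson_law (\<theta> * lam j))"
  obtain U where U: "random_variable borel U" "distr M borel U = uniform_measure lborel {0<..<1}"
    and ZU: "AE \<omega> in M. \<forall>j\<in>{1..d}. Z j \<omega> = quantile (?G j) (U \<omega>)"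
    using Z_comonotonic by blast
  interpret L: real_distribution "poisson_law r" for r
    by (rule real_distribution_poisson_law)
  show ?thesis
    using ZU AE_uniform[OF U]
  proof eventually_elim
    case (elim \<omega>)
    show ?case
    proof (intro impI ballI)
      fix j assume "Z i \<omega> \<le> x" and "j \<in> J"
      \<comment> \<open>As \<open>?G i\<close> tends to 1 and \<open>U \<omega> < 1\<close>, the
        quantile set is nonempty, as \<open>cInf_lessD\<close> demands.\<close>
      have "\<forall>\<^sub>F t in at_top. U \<omega> < ?G i t"
        using elim by (intro order_tendstoD(1)[OF L.cdf_lim_at_top_prob]) auto
      then obtain t0 where "U \<omega> \<le> ?G i t0"
        by (metis eventually_at_top_linorder less_imp_le order_refl)
      moreover have "Inf {t. U \<omega> \<le> ?G i t} < x + 1"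
        using elim \<open>Z i \<omega> \<le> x\<close> \<open>i \<in> {1..d}\<close> by (auto simp: quantile_def)
      ultimately obtain t where "U \<omega> \<le> ?G i t" "t < x + 1"
        using cInf_lessD[of "{t. U \<omega> \<le> ?G i t}"] by blast
      then have "U \<omega> \<le> ?G i (x + 1)"
        using L.cdf_nondecreasing[of t "x + 1"] by (meson less_imp_le order_trans)
      \<comment> \<open>If \<theta> = 0, the right-hand side is 1 and the bound is just
        \<open>U \<omega> < 1\<close>; otherwise it comes from \<open>small\<close>.\<close>
      then have "U \<omega> \<le> exp (- (\<theta> * lam j))"
        using small[OF \<open>j \<in> J\<close>] elim by auto
      then have "U \<omega> \<le> ?G j 0"
        using rate_nonneg(2)[of j] \<open>j \<in> J\<close> \<open>J \<subseteq> {1..d}\<close> by (simp add: cdf_poisson_law_0 subset_iff)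
      \<comment> \<open>\<open>?G j\<close> vanishes at negative points while
        \<open>U \<omega>\<close> is positive. Since 0 itself lies in the quantile set, it is the
        minimum.\<close>
      moreover have "0 \<le> t" if "U \<omega> \<le> ?G j t" for t
        using that elim cdf_poisson_law_eq_0[of t] by (force simp: not_less[symmetric])
      ultimately have "Inf {t. U \<omega> \<le> ?G j t} = 0"
        by (intro cInf_eq_minimum) auto
      then show "Z j \<omega> = 0"
        using elim \<open>j \<in> J\<close> \<open>J \<subseteq> {1..d}\<close> by (auto simp: quantile_def)
    qed
  qed
qed

text \<open>\<open>X i\<close> is a function of \<open>Y i\<close> and \<open>Z i\<close>, and this
  pair is independent of the \<open>Y j\<close> with \<open>j\<close> in \<open>J\<close>, because
  \<open>J\<close> avoids \<open>i\<close>.\<close>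

lemma indep_X_Y_others:
  assumes "i \<in> {1..d}" "J \<subseteq> {1..d} - {i}"
  shows "prob {\<omega> \<in> space M. X i \<omega> \<le> x \<and> (\<forall>j\<in>J. Y j \<omega> \<le> x)} =
    prob {\<omega> \<in> space M. X i \<omega> \<le> x} * prob {\<omega> \<in> space M. \<forall>j\<in>J. Y j \<omega> \<le> x}"
proof -
  let ?P = "\<lambda>K. PiM K (\<lambda>_::nat. borel :: real measure)"
  \<comment> \<open>\<open>Z i\<close> is stored at the index 0, which lies outside \<open>{1..d}\<close>.\<close>
  let ?W = "Y(0 := Z i)"
  have "indep_var (?P {1..d}) (id \<circ> (\<lambda>\<omega>. \<lambda>j\<in>{1..d}. Y j \<omega>))
      (?P {0}) ((\<lambda>v. \<lambda>j\<in>{0}. v i) \<circ> (\<lambda>\<omega>. \<lambda>j\<in>{1..d}. Z j \<omega>))"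
    using \<open>i \<in> {1..d}\<close> by (intro indep_var_compose[OF YZ_indep]) auto
  also have "id \<circ> (\<lambda>\<omega>. \<lambda>j\<in>{1..d}. Y j \<omega>) = (\<lambda>\<omega>. \<lambda>j\<in>{1..d}. ?W j \<omega>)"
    by (auto simp: fun_eq_iff)
  also have "(\<lambda>v. \<lambda>j\<in>{0}. v i) \<circ> (\<lambda>\<omega>. \<lambda>j\<in>{1..d}. Z j \<omega>) = (\<lambda>\<omega>. \<lambda>j\<in>{0}. ?W j \<omega>)"
    using \<open>i \<in> {1..d}\<close> by (auto simp: fun_eq_iff)
  finally have "indep_var (?P {1..d}) (\<lambda>\<omega>. \<lambda>j\<in>{1..d}. ?W j \<omega>) (?P {0}) (\<lambda>\<omega>. \<lambda>j\<in>{0}. ?W j \<omega>)" .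
  moreover have "indep_vars (\<lambda>_. borel) ?W {1..d}"
    using Y_indep by (subst indep_vars_cong[OF refl _ refl, of _ _ Y]) auto
  \<comment> \<open>The assumptions give independence of the vectors \<open>Y\<close> and
    \<open>Z\<close> and mutual independence of the \<open>Y j\<close>; together they make all
    \<open>Y j\<close> and the single shock \<open>Z i\<close> mutually independent.\<close>
  ultimately have W: "indep_vars (\<lambda>_. borel) ?W (insert 0 {1..d})"
    by (intro indep_vars_insert) auto
  \<comment> \<open>Grouping along the disjoint index sets \<open>{0, i}\<close> and
    \<open>J\<close> preserves independence.\<close>
  have "indep_var (?P {0, i}) (\<lambda>\<omega>. \<lambda>j\<in>{0, i}. ?W j \<omega>) (?P J) (\<lambda>\<omega>. \<lambda>j\<in>J. ?W j \<omega>)"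
    using assms by (intro indep_var_restrict[OF W]) auto
  moreover have A: "{v \<in> space (?P {0, i}). v i + v 0 \<le> x} \<in> sets (?P {0, i})"
    by measurable
  moreover have B: "{v \<in> space (?P J). \<forall>j\<in>J. v j \<le> x} \<in> sets (?P J)"
    using assms finite_subset[of J "{1..d} - {i}"] by measurable
  ultimately have *: "prob ((\<lambda>\<omega>. (\<lambda>j\<in>{0, i}. ?W j \<omega>, \<lambda>j\<in>J. ?W j \<omega>)) -`
        ({v \<in> space (?P {0, i}). v i + v 0 \<le> x} \<times> {v \<in> space (?P J). \<forall>j\<in>J. v j \<le> x}) \<inter> space M) =
      prob ((\<lambda>\<omega>. \<lambda>j\<in>{0, i}. ?W j \<omega>) -` {v \<in> space (?P {0, i}). v i + v 0 \<le> x} \<inter> space M) *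
      prob ((\<lambda>\<omega>. \<lambda>j\<in>J. ?W j \<omega>) -` {v \<in> space (?P J). \<forall>j\<in>J. v j \<le> x} \<inter> space M)"
    by (rule indep_varD)
  have "i \<noteq> 0" "0 \<notin> J"
    using assms by auto
  have 1: "(\<lambda>\<omega>. \<lambda>j\<in>{0, i}. ?W j \<omega>) -` {v \<in> space (?P {0, i}). v i + v 0 \<le> x} \<inter> space M =
      {\<omega> \<in> space M. X i \<omega> \<le> x}"
    using \<open>i \<noteq> 0\<close> X_eq[OF \<open>i \<in> {1..d}\<close>] by (auto simp: space_PiM)
  have 2: "(\<lambda>\<omega>. \<lambda>j\<in>J. ?W j \<omega>) -` {v \<in> space (?P J). \<forall>j\<in>J. v j \<le> x} \<inter> space M =
      {\<omega> \<in> space M. \<forall>j\<in>J. Y j \<omega> \<le> x}"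
    using \<open>0 \<notin> J\<close> by (auto simp: space_PiM)
  have 3: "(\<lambda>\<omega>. (\<lambda>j\<in>{0, i}. ?W j \<omega>, \<lambda>j\<in>J. ?W j \<omega>)) -`
        ({v \<in> space (?P {0, i}). v i + v 0 \<le> x} \<times> {v \<in> space (?P J). \<forall>j\<in>J. v j \<le> x}) \<inter> space M =
      {\<omega> \<in> space M. X i \<omega> \<le> x} \<inter> {\<omega> \<in> space M. \<forall>j\<in>J. Y j \<omega> \<le> x}"
    unfolding 1[symmetric] 2[symmetric] by auto
  show ?thesis
    using * unfolding 1 2 3 by (simp add: Collect_conj_eq[symmetric] Int_def conj_ac cong: conj_cong)
qed

text \<open>By independence the probability is a product of positive factors. It keeps the
  denominator of the first ratio away from 0.\<close>

lemma prob_Y_le_pos: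
  assumes "J \<subseteq> {1..d}" "0 \<le> x"
  shows "0 < prob {\<omega> \<in> space M. \<forall>j\<in>J. Y j \<omega> \<le> x}"
proof (cases "J = {}")
  case False
  have "0 < cdf (poisson_law ((1 - \<theta>) * lam j)) x" if "j \<in> J" for j
    using cdf_poisson_law_ge[OF rate_nonneg(1) \<open>0 \<le> x\<close>, of j] that assms(1)
    by (intro less_le_trans[OF exp_gt_zero]) auto
  then have "0 < (\<Prod>j\<in>J. prob {\<omega> \<in> space M. Y j \<omega> \<le> x})"
    using assms(1) prob_le_eq_cdf[OF Y_rv Y_law] by (intro prod_pos) (auto simp: subset_iff)
  also have "\<dots> = (\<Prod>j\<in>J. prob (Y j -` {..x} \<inter> space M))"
    by (intro prod.cong arg_cong[where f = prob]) auto
  also have "\<dots> = prob (\<Inter>j\<in>J. Y j -` {..x} \<inter> space M)"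
    using assms(1) finite_subset[OF assms(1)] False by (intro indep_varsD[OF Y_indep, symmetric]) auto
  also have "(\<Inter>j\<in>J. Y j -` {..x} \<inter> space M) = {\<omega> \<in> space M. \<forall>j\<in>J. Y j \<omega> \<le> x}"
    using False by auto
  finally show ?thesis .
qed (simp add: prob_space)

text \<open>\<open>Y j\<close> and \<open>Z j\<close> are both at most 0 with probability exp (- (1
  - \<theta>) \<lambda>_j) exp (- \<theta> \<lambda>_j), in which \<theta> cancels. For an index
  other than \<open>i\<close> the bound stays constant as \<lambda>_i grows.\<close>

lemma prob_X_le_ge:
  assumes j: "j \<in> {1..d}" and "0 \<le> x"
  shows "exp (- lam j) \<le> prob {\<omega> \<in> space M. X j \<omega> \<le> x}"
proof -
  note [measurable] = X_rv[OF j]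
  have "indep_var borel ((\<lambda>v. v j) \<circ> (\<lambda>\<omega>. \<lambda>j\<in>{1..d}. Y j \<omega>))
      borel ((\<lambda>v. v j) \<circ> (\<lambda>\<omega>. \<lambda>j\<in>{1..d}. Z j \<omega>))"
    using j by (intro indep_var_compose[OF YZ_indep]) auto
  then have YZ: "indep_var borel (Y j) borel (Z j)"
    using j by (simp add: comp_def)
  have "exp (- lam j) = cdf (poisson_law ((1 - \<theta>) * lam j)) 0 * cdf (poisson_law (\<theta> * lam j)) 0"
    using rate_nonneg[OF j] by (simp add: cdf_poisson_law_0 exp_add[symmetric] algebra_simps)
  also have "\<dots> = prob (Y j -` {..0} \<inter> space M) * prob (Z j -` {..0} \<inter> space M)"
    unfolding prob_le_eq_cdf[OF Y_rv[OF j] Y_law[OF j], symmetric]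
      prob_le_eq_cdf[OF Z_rv[OF j] Z_law[OF j], symmetric]
    by (intro arg_cong2[where f = "(*)"] arg_cong[where f = prob]) auto
  also have "\<dots> = prob ((\<lambda>\<omega>. (Y j \<omega>, Z j \<omega>)) -` ({..0} \<times> {..0}) \<inter> space M)"
    by (intro indep_varD[OF YZ, symmetric]) auto
  also have "\<dots> \<le> prob {\<omega> \<in> space M. X j \<omega> \<le> x}"
    using X_eq[OF j] \<open>0 \<le> x\<close> by (intro finite_measure_mono) auto
  finally show ?thesis .
qed

text \<open>Both summands are almost surely nonnegative, so neither exceeds their sum. Two bounds
  are kept because one of the rates is 0 when \<theta> is 0 or 1, and the corresponding bound then
  does not decay.\<close>

lemma prob_X_le_le:
  assumes j: "j \<in> {1..d}"
  shows "prob {\<omega> \<in> space M. X j \<omega> \<le> x} \<le> cdf (poisson_law ((1 - \<theta>) * lam j)) x"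
    and "prob {\<omega> \<in> space M. X j \<omega> \<le> x} \<le> cdf (poisson_law (\<theta> * lam j)) x"
proof -
  note [measurable] = X_rv[OF j] Y_rv[OF j] Z_rv[OF j]
  have *: "AE \<omega> in M. X j \<omega> \<le> x \<longrightarrow> Y j \<omega> \<le> x \<and> Z j \<omega> \<le> x"
    using AE_nonneg AE_space by eventually_elim (use j X_eq in force)
  have "prob {\<omega> \<in> space M. X j \<omega> \<le> x} \<le> prob {\<omega> \<in> space M. Y j \<omega> \<le> x}"
    using * by (intro finite_measure_mono_AE) auto
  then show "prob {\<omega> \<in> space M. X j \<omega> \<le> x} \<le> cdf (poisson_law ((1 - \<theta>) * lam j)) x"
    using prob_le_eq_cdf[OF Y_rv[OF j] Y_law[OF j]] by simp
  have "prob {\<omega> \<in> space M. X j \<omega> \<le> x} \<le> prob {\<omega> \<in> space M. Z j \<omega> \<le> x}"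
    using * by (intro finite_measure_mono_AE) auto
  then show "prob {\<omega> \<in> space M. X j \<omega> \<le> x} \<le> cdf (poisson_law (\<theta> * lam j)) x"
    using prob_le_eq_cdf[OF Z_rv[OF j] Z_law[OF j]] by simp
qed

text \<open>The identity is exact, not asymptotic: \<open>small\<close> is all that a large
  \<lambda>_i has to provide.\<close>

lemma vmax_ratio_eq_1:
  assumes i: "i \<in> {1..d}" and "2 \<le> d" "0 \<le> x"
    and small: "\<And>j. j \<in> {1..d} - {i} \<Longrightarrow>
      \<theta> = 0 \<or> cdf (poisson_law (\<theta> * lam i)) (x + 1) \<le> exp (- (\<theta> * lam j))"
  shows "cdf_of M (vmax {1..d} X) x / (cdf_of M (X i) x * cdf_of M (vmax ({1..d} - {i}) Y) x) = 1"
proof -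
  let ?J = "{1..d} - {i}"
  note [measurable] = X_rv Y_rv
  have shock_0: "AE \<omega> in M. Z i \<omega> \<le> x \<longrightarrow> (\<forall>j\<in>?J. Z j \<omega> = 0)"
    using small by (intro AE_shock_eq_0 i) auto
  have "?J \<noteq> {}"
    using \<open>2 \<le> d\<close> by (auto simp: set_eq_iff) (metis One_nat_def Suc_1 Suc_leD le_refl n_not_Suc_n)
  have "cdf_of M (vmax {1..d} X) x = prob {\<omega> \<in> space M. \<forall>j\<in>{1..d}. X j \<omega> \<le> x}"
    using i X_rv by (intro cdf_of_vmax) auto
  also have "\<dots> = prob {\<omega> \<in> space M. X i \<omega> \<le> x \<and> (\<forall>j\<in>?J. Y j \<omega> \<le> x)}"
  proof (intro measure_eq_AE)
    show "AE \<omega> in M. \<omega> \<in> {\<omega> \<in> space M. \<forall>j\<in>{1..d}. X j \<omega> \<le> x} \<longleftrightarrow>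
        \<omega> \<in> {\<omega> \<in> space M. X i \<omega> \<le> x \<and> (\<forall>j\<in>?J. Y j \<omega> \<le> x)}"
      using shock_0 AE_nonneg AE_space
    proof eventually_elim
      case (elim \<omega>)
      have "(\<forall>j\<in>{1..d}. X j \<omega> \<le> x) \<longleftrightarrow> X i \<omega> \<le> x \<and> (\<forall>j\<in>?J. X j \<omega> \<le> x)"
        using i by auto
      also have "\<dots> \<longleftrightarrow> X i \<omega> \<le> x \<and> (\<forall>j\<in>?J. Y j \<omega> \<le> x)"
      proof (intro conj_cong refl ball_cong)
        \<comment> \<open>Since \<open>Y i\<close> is nonnegative, the bound on \<open>X i\<close>
          passes to \<open>Z i\<close>, which triggers \<open>shock_0\<close>.\<close>
        fix j assume "X i \<omega> \<le> x" "j \<in> ?J"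
        moreover have "X i \<omega> = Y i \<omega> + Z i \<omega>" "0 \<le> Y i \<omega>"
          using i elim X_eq[of i \<omega>] by auto
        ultimately have "Z j \<omega> = 0"
          using elim by auto
        then show "X j \<omega> \<le> x \<longleftrightarrow> Y j \<omega> \<le> x"
          using elim X_eq[of j \<omega>] \<open>j \<in> ?J\<close> by auto
      qed
      finally show ?case
        using elim by auto
    qed
  qed (use i in measurable)
  also have "\<dots> = prob {\<omega> \<in> space M. X i \<omega> \<le> x} * prob {\<omega> \<in> space M. \<forall>j\<in>?J. Y j \<omega> \<le> x}"
    using i by (intro indep_X_Y_others) auto
  also have "prob {\<omega> \<in> space M. X i \<omega> \<le> x} = cdf_of M (X i) x"
    using i X_rv by (simp add: cdf_of_eq_prob)
  also have "prob {\<omega> \<in> space M. \<forall>j\<in>?J. Y j \<omega> \<le> x} = cdf_of M (vmax ?J Y) x"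
    using \<open>?J \<noteq> {}\<close> Y_rv by (intro cdf_of_vmax[symmetric]) auto
  finally have "cdf_of M (vmax {1..d} X) x = cdf_of M (X i) x * cdf_of M (vmax ?J Y) x" .
  \<comment> \<open>Equality of numerator and denominator gives ratio 1 only if they are nonzero, as
    division by 0 yields 0.\<close>
  moreover have "0 < cdf_of M (X i) x"
    using prob_X_le_ge[OF i \<open>0 \<le> x\<close>] X_rv[OF i]
    by (simp add: cdf_of_eq_prob less_le_trans[OF exp_gt_zero])
  moreover have "0 < cdf_of M (vmax ?J Y) x"
    using prob_Y_le_pos[of ?J x] \<open>?J \<noteq> {}\<close> Y_rv \<open>0 \<le> x\<close> by (subst cdf_of_vmax) auto
  ultimately show ?thesis
    by simp
qed

text \<open>The event for the full minimum is the union of the event for the others and of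
  \<open>X i \<omega> \<le> x\<close>: monotonicity gives the lower bound, subadditivity the upper
  one.\<close>

lemma vmin_ratio_bounds:
  assumes i: "i \<in> {1..d}" and j: "j \<in> {1..d} - {i}" and "0 \<le> x"
  defines "R \<equiv> cdf_of M (vmin {1..d} X) x / cdf_of M (vmin ({1..d} - {i}) X) x"
  shows "1 \<le> R" "R \<le> 1 + prob {\<omega> \<in> space M. X i \<omega> \<le> x} / exp (- lam j)"
proof -
  let ?J = "{1..d} - {i}"
  let ?p = "prob {\<omega> \<in> space M. X i \<omega> \<le> x}"
  note [measurable] = X_rv X_rv[OF i]
  define m where "m = cdf_of M (vmin {1..d} X) x"
  define m' where "m' = cdf_of M (vmin ?J X) x"
  have m: "m = prob {\<omega> \<in> space M. \<exists>k\<in>{1..d}. X k \<omega> \<le> x}"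
    unfolding m_def using i X_rv by (intro cdf_of_vmin) auto
  have m': "m' = prob {\<omega> \<in> space M. \<exists>k\<in>?J. X k \<omega> \<le> x}"
    unfolding m'_def using j X_rv by (intro cdf_of_vmin) auto
  have "exp (- lam j) \<le> prob {\<omega> \<in> space M. X j \<omega> \<le> x}"
    using j \<open>0 \<le> x\<close> by (intro prob_X_le_ge) auto
  also have "\<dots> \<le> m'"
    unfolding m' using j by (intro finite_measure_mono) auto
  finally have pos: "exp (- lam j) \<le> m'" .
  then have "0 < m'"
    using exp_gt_zero less_le_trans by blast
  have "m' \<le> m"
    unfolding m m' by (intro finite_measure_mono) auto
  then show "1 \<le> R"
    using \<open>0 < m'\<close> unfolding R_def m_def[symmetric] m'_def[symmetric] by simp
  have "{\<omega> \<in> space M. \<exists>k\<in>{1..d}. X k \<omega> \<le> x} =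
      {\<omega> \<in> space M. \<exists>k\<in>?J. X k \<omega> \<le> x} \<union> {\<omega> \<in> space M. X i \<omega> \<le> x}"
    using i by auto
  then have "m \<le> m' + ?p"
    unfolding m m' by (simp only:) (intro measure_Un_le; measurable)
  then have "R \<le> 1 + ?p / m'"
    using \<open>0 < m'\<close> unfolding R_def m_def[symmetric] m'_def[symmetric] by (simp add: field_simps)
  \<comment> \<open>With \<open>m'\<close> replaced by its constant lower bound, the estimate
    depends on \<lambda>_i through \<open>?p\<close> only.\<close>
  also have "?p / m' \<le> ?p / exp (- lam j)"
    using pos by (intro divide_left_mono mult_pos_pos \<open>0 < m'\<close>) auto
  finally show "R \<le> 1 + ?p / exp (- lam j)"
    by simp
qed

end

text \<open>The variable \<open>t\<close> is the rate \<lambda>_i. Each \<open>t\<close> may have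
  its own probability space, since the claim concerns laws only; \<open>2 \<le> d\<close> gives the
  extrema over the other indices a meaning.\<close>

theorem proposition4p4:
  fixes d i x :: nat and lam :: "nat \<Rightarrow> real" and \<theta> :: real
    and M :: "real \<Rightarrow> 'a measure"
    and X Y Z :: "real \<Rightarrow> nat \<Rightarrow> 'a \<Rightarrow> real"
  assumes "2 \<le> d" and "i \<in> {1..d}"
    and "\<And>j. j \<in> {1..d} \<Longrightarrow> 0 < lam j"
    and "0 \<le> \<theta>" and "\<theta> \<le> 1"
    and "\<And>t. 0 < t \<Longrightarrow>
           comonotonic_shock_poisson (M t) d (lam(i := t)) \<theta> (X t) (Y t) (Z t)"
  shows "((\<lambda>t. cdf_of (M t) (vmax {1..d} (X t)) (real x)
             / (cdf_of (M t) (X t i) (real x)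
                * cdf_of (M t) (vmax ({1..d} - {i}) (Y t)) (real x))) \<longlongrightarrow> 1) at_top
       \<and> ((\<lambda>t. cdf_of (M t) (vmin {1..d} (X t)) (real x)
             / cdf_of (M t) (vmin ({1..d} - {i}) (X t)) (real x)) \<longlongrightarrow> 1) at_top"
proof -
  let ?J = "{1..d} - {i}"
  note shock = assms(6)
  have "\<forall>\<^sub>F t in at_top. \<forall>j\<in>?J. \<theta> = 0 \<or>
      cdf (poisson_law (\<theta> * t)) (real x + 1) \<le> exp (- (\<theta> * lam j))"
  proof (cases "\<theta> = 0")
    case False
    \<comment> \<open>The left side tends to 0 because \<theta> is positive, the right side is a
      positive constant, and finitely many \<open>j\<close> are involved. Writing
      \<open>real (x + 1)\<close> fits the limit at natural arguments.\<close>
    then have "\<forall>\<^sub>F t in at_top. cdf (poisson_law (\<theta> * t)) (real (x + 1)) < exp (- (\<theta> * lam j))" for j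
      using assms(4) by (intro order_tendstoD(2)[OF cdf_poisson_law_scaled_tendsto_0]) auto
    then have "\<forall>\<^sub>F t in at_top. \<forall>j\<in>?J. cdf (poisson_law (\<theta> * t)) (real (x + 1)) < exp (- (\<theta> * lam j))"
      by (intro eventually_ball_finite) auto
    then show ?thesis
      by eventually_elim (auto simp: add.commute intro: less_imp_le)
  qed simp
  then have "\<forall>\<^sub>F t in at_top. cdf_of (M t) (vmax {1..d} (X t)) (real x)
      / (cdf_of (M t) (X t i) (real x) * cdf_of (M t) (vmax ?J (Y t)) (real x)) = 1"
    using eventually_gt_at_top[of 0]
  proof eventually_elim
    case (elim t)
    show ?case
      using elim assms(1,2)
      by (intro comonotonic_shock_poisson.vmax_ratio_eq_1[OF shock]) auto
  qed
  then have "((\<lambda>t. cdf_of (M t) (vmax {1..d} (X t)) (real x)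
             / (cdf_of (M t) (X t i) (real x)
                * cdf_of (M t) (vmax ?J (Y t)) (real x))) \<longlongrightarrow> 1) at_top"
    by (rule tendsto_eventually)
  moreover
  let ?p = "\<lambda>t. measure (M t) {\<omega> \<in> space (M t). X t i \<omega> \<le> real x}"
  obtain j where j: "j \<in> ?J"
    using assms(1,2) that[of 1] that[of 2] by (cases "i = 1") auto
  \<comment> \<open>The larger of the two shares of the rate is at least 1/2, so for every \<theta>
    it selects a bound of \<open>prob_X_le_le\<close> that tends to 0.\<close>
  define c where "c = max \<theta> (1 - \<theta>)"
  have "0 < c"
    by (auto simp: c_def)
  have p_le: "?p t \<le> cdf (poisson_law (c * t)) (real x)" if "0 < t" for t
    using comonotonic_shock_poisson.prob_X_le_le[OF shock[OF that] assms(2), of "real x"]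
    by (auto simp: c_def max_def)
  have "((\<lambda>t. 1 + cdf (poisson_law (c * t)) (real x) / exp (- lam j)) \<longlongrightarrow> 1 + 0 / exp (- lam j)) at_top"
    using \<open>0 < c\<close> by (intro tendsto_intros cdf_poisson_law_scaled_tendsto_0) auto
  then have upper: "((\<lambda>t. 1 + cdf (poisson_law (c * t)) (real x) / exp (- lam j)) \<longlongrightarrow> 1) at_top"
    by simp
  have "((\<lambda>t. cdf_of (M t) (vmin {1..d} (X t)) (real x)
             / cdf_of (M t) (vmin ?J (X t)) (real x)) \<longlongrightarrow> 1) at_top"
  proof (rule tendsto_sandwich[OF _ _ tendsto_const upper])
    show "\<forall>\<^sub>F t in at_top. 1 \<le> cdf_of (M t) (vmin {1..d} (X t)) (real x)
             / cdf_of (M t) (vmin ?J (X t)) (real x)"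
      using eventually_gt_at_top[of 0]
    proof eventually_elim
      case (elim t)
      then show ?case
        using j by (intro comonotonic_shock_poisson.vmin_ratio_bounds(1)[OF shock assms(2) j]) auto
    qed
    show "\<forall>\<^sub>F t in at_top. cdf_of (M t) (vmin {1..d} (X t)) (real x)
             / cdf_of (M t) (vmin ?J (X t)) (real x)
           \<le> 1 + cdf (poisson_law (c * t)) (real x) / exp (- lam j)"
      using eventually_gt_at_top[of 0]
    proof eventually_elim
      case (elim t)
      have "cdf_of (M t) (vmin {1..d} (X t)) (real x) / cdf_of (M t) (vmin ?J (X t)) (real x)
          \<le> 1 + ?p t / exp (- (lam(i := t)) j)"
        using elim by (intro comonotonic_shock_poisson.vmin_ratio_bounds(2)[OF shock assms(2) j]) auto
      \<comment> \<open>As \<open>j\<close> differs from \<open>i\<close>, the updated rate at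
        \<open>j\<close> is still \<open>lam j\<close>, independent of \<open>t\<close>.\<close>
      also have "\<dots> \<le> 1 + cdf (poisson_law (c * t)) (real x) / exp (- lam j)"
        using p_le[OF elim] j by (auto intro!: divide_right_mono)
      finally show ?case .
    qed
  qed
  ultimately show ?thesis
    by simp
qed

end
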